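(* Let $R$ be a commutative ring, let $\mathfrak{a}\subseteq R$ be an ideal, and let $M$ be an $R$-module. If $M$ is weakly $\mathfrak{a}$-fair, then it is weakly $\mathfrak{a}$-quasifair.
   Context: Rings are commutative with unit (not assumed noetherian). $\mathrm{Var}(\mathfrak{a})$ is the set of prime ideals of $R$ containing $\mathfrak{a}$, and $\Gamma_{\mathfrak{a}}(M)=\{x\in M\mid\exists n\in\mathbb{N}:\mathfrak{a}^nx=0\}$. For $x\in M$, $(0:_Rx)=\{r\in R\mid rx=0\}$. The weak assassin $\mathrm{Ass}^{\rm f}_R(M)$ is the set of prime ideals $\mathfrak{p}$ of $R$ such that there exists $x\in M$ for which $\mathfrak{p}$ is minimal (with respect to inclusion) among the prime ideals containing $(0:_Rx)$. The $R$-module $M$ is called weakly $\mathfrak{a}$-quasifair if $\mathrm{Ass}^{\rm f}_R(\Gamma_{\mathfrak{a}}(M))=\mathrm{Ass}^{\rm f}_R(M)\cap\mathrm{Var}(\mathfrak{a})$, and weakly $\mathfrak{a}$-fair if $\mathrm{Ass}^{\rm f}_R(M/\Gamma_{\mathfrak{a}}(M))=\mathrm{Ass}^{\rm f}_R(M)\setminus\mathrm{Var}(\mathfrak{a})$. *)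

theory Defs
  imports "HOL-Algebra.Module" "HOL-Algebra.QuotRing" "HOL-Algebra.Ideal_Product"
begin

definition Var :: "('a, 'r) ring_scheme \<Rightarrow> 'a set \<Rightarrow> 'a set set"
  where "Var R \<aa> = {\<pp>. primeideal \<pp> R \<and> \<aa> \<subseteq> \<pp>}"

definition annihilator ::
    "('a, 'r) ring_scheme \<Rightarrow> ('a, 'b, 'm) module_scheme \<Rightarrow> 'b \<Rightarrow> 'a set"
  where "annihilator R M x = {r \<in> carrier R. r \<odot>\<^bsub>M\<^esub> x = \<zero>\<^bsub>M\<^esub>}"

text \<open>
  Powers of an ideal are taken in the multiplicative monoid \<^const>\<open>ideals_set\<close> of all ideals, so
  the zeroth power is the unit ideal.
\<close>

definition torsion ::
    "('a, 'r) ring_scheme \<Rightarrow> 'a set \<Rightarrow> ('a, 'b, 'm) module_scheme \<Rightarrow> 'b set"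
  where "torsion R \<aa> M =
    {x \<in> carrier M. \<exists>n::nat. \<forall>r \<in> \<aa> [^]\<^bsub>ideals_set R\<^esub> n. r \<odot>\<^bsub>M\<^esub> x = \<zero>\<^bsub>M\<^esub>}"

definition torsion_module ::
    "('a, 'r) ring_scheme \<Rightarrow> 'a set \<Rightarrow> ('a, 'b, 'm) module_scheme \<Rightarrow> ('a, 'b, 'm) module_scheme"
  where "torsion_module R \<aa> M = M\<lparr>carrier := torsion R \<aa> M\<rparr>"

text \<open>
  The multiplicative fields of the record are part of every \<open>module\<close> record but have no
  meaning for modules; they are filled in as for \<^const>\<open>FactRing\<close>.
\<close>

definition quotient_module ::
    "('a, 'b, 'm) module_scheme \<Rightarrow> 'b set \<Rightarrow> ('a, 'b set) module"
  where "quotient_module M N =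
    \<lparr>carrier = a_rcosets\<^bsub>M\<^esub> N, mult = rcoset_mult M N, one = N +>\<^bsub>M\<^esub> \<one>\<^bsub>M\<^esub>,
     zero = N, add = set_add M, smult = (\<lambda>r S. \<Union>x\<in>S. N +>\<^bsub>M\<^esub> (r \<odot>\<^bsub>M\<^esub> x))\<rparr>"

definition minimal_prime_over :: "('a, 'r) ring_scheme \<Rightarrow> 'a set \<Rightarrow> 'a set \<Rightarrow> bool"
  where "minimal_prime_over R I \<pp> \<longleftrightarrow>
    \<pp> \<in> Var R I \<and> (\<forall>\<qq> \<in> Var R I. \<qq> \<subseteq> \<pp> \<longrightarrow> \<qq> = \<pp>)"

definition weak_assassin ::
    "('a, 'r) ring_scheme \<Rightarrow> ('a, 'b, 'm) module_scheme \<Rightarrow> 'a set set"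
  where "weak_assassin R M =
    {\<pp>. primeideal \<pp> R \<and> (\<exists>x \<in> carrier M. minimal_prime_over R (annihilator R M x) \<pp>)}"

definition weakly_quasifair ::
    "('a, 'r) ring_scheme \<Rightarrow> 'a set \<Rightarrow> ('a, 'b, 'm) module_scheme \<Rightarrow> bool"
  where "weakly_quasifair R \<aa> M \<longleftrightarrow>
    weak_assassin R (torsion_module R \<aa> M) = weak_assassin R M \<inter> Var R \<aa>"

definition weakly_fair ::
    "('a, 'r) ring_scheme \<Rightarrow> 'a set \<Rightarrow> ('a, 'b, 'm) module_scheme \<Rightarrow> bool"
  where "weakly_fair R \<aa> M \<longleftrightarrow>
    weak_assassin R (quotient_module M (torsion R \<aa> M)) = weak_assassin R M - Var R \<aa>"

text \<open>The quotient and torsion constructions do yield modules.\<close>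

lemma (in module) smult_rcos:
  assumes N: "submodule N R M" and r: "r \<in> carrier R" and x: "x \<in> carrier M"
  shows "r \<odot>\<^bsub>quotient_module M N\<^esub> (N +>\<^bsub>M\<^esub> x) = N +>\<^bsub>M\<^esub> (r \<odot>\<^bsub>M\<^esub> x)"
proof -
  interpret N: abelian_subgroup N M
    using N by (intro abelian_subgroupI3 additive_subgroup.intro)
      (auto simp: submodule_def abelian_group_axioms)
  have "N +>\<^bsub>M\<^esub> (r \<odot>\<^bsub>M\<^esub> y) = N +>\<^bsub>M\<^esub> (r \<odot>\<^bsub>M\<^esub> x)" if y: "y \<in> N +>\<^bsub>M\<^esub> x" for y
  proof -
    obtain h where h: "h \<in> N" "y = h \<oplus>\<^bsub>M\<^esub> x"
      using y by (auto simp: a_r_coset_def r_coset_def)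
    have hM: "h \<in> carrier M" using h by simp
    have "r \<odot>\<^bsub>M\<^esub> h \<in> N" using submoduleE(4)[OF N r h(1)] .
    moreover have "r \<odot>\<^bsub>M\<^esub> y = r \<odot>\<^bsub>M\<^esub> h \<oplus>\<^bsub>M\<^esub> r \<odot>\<^bsub>M\<^esub> x"
      using h hM r x by (simp add: smult_r_distr)
    ultimately have "r \<odot>\<^bsub>M\<^esub> y \<in> N +>\<^bsub>M\<^esub> (r \<odot>\<^bsub>M\<^esub> x)"
      by (auto simp: a_r_coset_def r_coset_def)
    from N.a_repr_independence'[OF this] show ?thesis
      using r x by simp
  qed
  moreover have "x \<in> N +>\<^bsub>M\<^esub> x" using N.a_rcos_self x by simp
  ultimately have "(\<Union>y \<in> N +>\<^bsub>M\<^esub> x. N +>\<^bsub>M\<^esub> (r \<odot>\<^bsub>M\<^esub> y)) = N +>\<^bsub>M\<^esub> (r \<odot>\<^bsub>M\<^esub> x)"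
    by blast
  then show ?thesis by (simp add: quotient_module_def)
qed

lemma (in module) quotient_module_is_module:
  assumes N: "submodule N R M"
  shows "module R (quotient_module M N)"
proof -
  interpret N: abelian_subgroup N M
    using N by (intro abelian_subgroupI3 additive_subgroup.intro)
      (auto simp: submodule_def abelian_group_axioms)
  let ?Q = "quotient_module M N"
  have car: "carrier ?Q = (\<lambda>x. N +>\<^bsub>M\<^esub> x) ` carrier M"
    by (auto simp: quotient_module_def A_RCOSETS_def' a_r_coset_def r_coset_def)
  have add: "(N +>\<^bsub>M\<^esub> x) \<oplus>\<^bsub>?Q\<^esub> (N +>\<^bsub>M\<^esub> y) = N +>\<^bsub>M\<^esub> (x \<oplus>\<^bsub>M\<^esub> y)"
    if "x \<in> carrier M" "y \<in> carrier M" for x y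
    using N.a_rcos_sum that by (simp add: quotient_module_def)
  have zero: "\<zero>\<^bsub>?Q\<^esub> = N +>\<^bsub>M\<^esub> \<zero>\<^bsub>M\<^esub>"
    by (simp add: quotient_module_def a_coset_join2 N.a_subgroup)
  have ab: "abelian_group ?Q"
  proof (rule abelian_groupI)
    show "X \<oplus>\<^bsub>?Q\<^esub> Y = Y \<oplus>\<^bsub>?Q\<^esub> X" if "X \<in> carrier ?Q" "Y \<in> carrier ?Q" for X Y
      using that unfolding car by (elim imageE) (simp add: add M.a_comm)
    show "\<exists>Y \<in> carrier ?Q. Y \<oplus>\<^bsub>?Q\<^esub> X = \<zero>\<^bsub>?Q\<^esub>" if X: "X \<in> carrier ?Q" for X
    proof -
      obtain x where x: "x \<in> carrier M" "X = N +>\<^bsub>M\<^esub> x" using X by (auto simp: car)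
      show ?thesis
        using x by (intro bexI[of _ "N +>\<^bsub>M\<^esub> (\<ominus>\<^bsub>M\<^esub> x)"])
          (simp_all add: car add zero M.l_neg)
    qed
  qed (auto simp: car add zero M.a_assoc)
  show ?thesis
    by (rule moduleI[OF R.is_cring ab])
      (auto simp: car add smult_rcos[OF N] smult_l_distr smult_r_distr smult_assoc1)
qed

lemma (in cring) ideal_power_is_ideal:
  assumes "ideal \<aa> R"
  shows "ideal (\<aa> [^]\<^bsub>ideals_set R\<^esub> (n::nat)) R"
proof (induction n)
  case 0
  then show ?case by (simp add: nat_pow_def ideals_set_def oneideal)
next
  case (Suc n)
  then have "ideal ((\<aa> [^]\<^bsub>ideals_set R\<^esub> n) \<cdot> \<aa>) R"
    using assms by (rule ideal_prod_is_ideal)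
  then show ?case by (simp add: nat_pow_def ideals_set_def)
qed

lemma (in cring) ideal_power_antimono:
  assumes "ideal \<aa> R" "m \<le> n"
  shows "\<aa> [^]\<^bsub>ideals_set R\<^esub> (n::nat) \<subseteq> \<aa> [^]\<^bsub>ideals_set R\<^esub> m"
  using assms(2)
proof (induction n rule: dec_induct)
  case base
  show ?case by simp
next
  case (step n)
  have "\<aa> [^]\<^bsub>ideals_set R\<^esub> Suc n = (\<aa> [^]\<^bsub>ideals_set R\<^esub> n) \<cdot> \<aa>"
    by (simp add: nat_pow_def ideals_set_def)
  also have "\<dots> \<subseteq> \<aa> [^]\<^bsub>ideals_set R\<^esub> n"
    using ideal_prod_inter[OF ideal_power_is_ideal[OF assms(1)] assms(1)] by blast
  finally show ?case using step.IH by blast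
qed

lemma (in module) torsion_submodule:
  assumes a: "ideal \<aa> R"
  shows "submodule (torsion R \<aa> M) R M"
proof (rule submoduleI)
  have carr: "r \<in> carrier R" if "r \<in> \<aa> [^]\<^bsub>ideals_set R\<^esub> (n::nat)" for r n
    using ideal.Icarr[OF R.ideal_power_is_ideal[OF a] that] .
  show "torsion R \<aa> M \<subseteq> carrier M" by (auto simp: torsion_def)
  show "\<zero>\<^bsub>M\<^esub> \<in> torsion R \<aa> M" by (auto simp: torsion_def carr)
  show "\<ominus>\<^bsub>M\<^esub> x \<in> torsion R \<aa> M" if "x \<in> torsion R \<aa> M" for x
    using that by (fastforce simp: torsion_def smult_r_minus carr)
  show "x \<oplus>\<^bsub>M\<^esub> y \<in> torsion R \<aa> M" if xy: "x \<in> torsion R \<aa> M" "y \<in> torsion R \<aa> M" for x y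
  proof -
    obtain m n :: nat where
      m: "\<forall>r \<in> \<aa> [^]\<^bsub>ideals_set R\<^esub> m. r \<odot>\<^bsub>M\<^esub> x = \<zero>\<^bsub>M\<^esub>" and
      n: "\<forall>r \<in> \<aa> [^]\<^bsub>ideals_set R\<^esub> n. r \<odot>\<^bsub>M\<^esub> y = \<zero>\<^bsub>M\<^esub>"
      using xy by (auto simp: torsion_def)
    have c: "x \<in> carrier M" "y \<in> carrier M" using xy by (auto simp: torsion_def)
    have "r \<odot>\<^bsub>M\<^esub> (x \<oplus>\<^bsub>M\<^esub> y) = \<zero>\<^bsub>M\<^esub>" if r: "r \<in> \<aa> [^]\<^bsub>ideals_set R\<^esub> (max m n)" for r
    proof -
      have "r \<in> \<aa> [^]\<^bsub>ideals_set R\<^esub> m" "r \<in> \<aa> [^]\<^bsub>ideals_set R\<^esub> n"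
        using r R.ideal_power_antimono[OF a, of m "max m n"]
          R.ideal_power_antimono[OF a, of n "max m n"] by auto
      then show ?thesis using m n c carr[OF r] by (simp add: smult_r_distr)
    qed
    then show ?thesis using c by (auto simp: torsion_def)
  qed
  show "s \<odot>\<^bsub>M\<^esub> x \<in> torsion R \<aa> M" if s: "s \<in> carrier R" and x: "x \<in> torsion R \<aa> M" for s x
  proof -
    obtain n :: nat where n: "\<forall>r \<in> \<aa> [^]\<^bsub>ideals_set R\<^esub> n. r \<odot>\<^bsub>M\<^esub> x = \<zero>\<^bsub>M\<^esub>"
      using x by (auto simp: torsion_def)
    have c: "x \<in> carrier M" using x by (auto simp: torsion_def)
    have "r \<odot>\<^bsub>M\<^esub> (s \<odot>\<^bsub>M\<^esub> x) = \<zero>\<^bsub>M\<^esub>" if r: "r \<in> \<aa> [^]\<^bsub>ideals_set R\<^esub> n" for r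
      using ideal.I_r_closed[OF R.ideal_power_is_ideal[OF a] r s] n c s carr[OF r]
      by (simp add: smult_assoc1[symmetric])
    then show ?thesis using c s by (auto simp: torsion_def)
  qed
qed

lemma (in module) torsion_module_is_module:
  assumes "ideal \<aa> R"
  shows "module R (torsion_module R \<aa> M)"
  unfolding torsion_module_def
  using submodule.submodule_is_module[OF torsion_submodule[OF assms]] module_axioms by blast

end

theory Submission
  imports Defs
begin

text \<open>
  Every prime of the weak assassin of \<open>M\<close> belongs to the weak assassin of a given submodule \<open>N\<close> or
  to that of \<open>M/N\<close> (\<open>weak_assassin_subset_submodule_quotient\<close>). Apply this to the torsion submodule
  \<open>\<Gamma>\<close> and a prime \<open>\<pp> \<supseteq> \<aa>\<close> in the weak assassin of \<open>M\<close>: fairness says that no prime in the weak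
  assassin of \<open>M/\<Gamma>\<close> contains \<open>\<aa>\<close>, so \<open>\<pp>\<close> must come from \<open>\<Gamma>\<close>. The other inclusion,
  \<open>weak_assassin_torsion_subset\<close>, holds for every module, because a prime that contains a power of
  \<open>\<aa>\<close> contains \<open>\<aa>\<close>.

  The statement about \<open>N\<close> and \<open>M/N\<close> rests on the fact that a prime minimal over \<open>I\<close> remains minimal
  over any larger set inside it (\<open>minimal_prime_over_between\<close>). So, once \<open>\<pp>\<close> is minimal
  over the annihilator of some \<open>x\<close>, it suffices to find a larger annihilator inside \<open>\<pp>\<close>, of an
  element of \<open>N\<close> or of \<open>M/N\<close>.
\<close>

lemma minimal_prime_over_between:
  assumes "minimal_prime_over R I \<pp>" "I \<subseteq> J" "J \<subseteq> \<pp>"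
  shows "minimal_prime_over R J \<pp>"
  using assms unfolding minimal_prime_over_def Var_def by blast

lemma (in cring) ideal_power_subset_prime:
  assumes \<aa>: "ideal \<aa> R" and \<pp>: "primeideal \<pp> R"
    and sub: "\<aa> [^]\<^bsub>ideals_set R\<^esub> (n::nat) \<subseteq> \<pp>"
  shows "\<aa> \<subseteq> \<pp>"
  using sub
proof (induction n)
  case 0
  then have "carrier R \<subseteq> \<pp>"
    by (simp add: nat_pow_def ideals_set_def)
  then show ?case
    using ideal.Icarr[OF \<aa>] by blast
next
  case (Suc n)
  have "\<aa> [^]\<^bsub>ideals_set R\<^esub> Suc n = (\<aa> [^]\<^bsub>ideals_set R\<^esub> n) \<cdot> \<aa>"
    by (simp add: nat_pow_def ideals_set_def)
  then have "\<aa> [^]\<^bsub>ideals_set R\<^esub> n \<subseteq> \<pp> \<or> \<aa> \<subseteq> \<pp>"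
    using Suc.prems primeideal_divides_ideal_prod[OF \<pp> ideal_power_is_ideal[OF \<aa>] \<aa>]
    by blast
  then show ?case
    using Suc.IH by blast
qed

lemma (in module) annihilator_subset_smult:
  assumes "s \<in> carrier R" "x \<in> carrier M"
  shows "annihilator R M x \<subseteq> annihilator R M (s \<odot>\<^bsub>M\<^esub> x)"
proof
  fix r assume "r \<in> annihilator R M x"
  then have r: "r \<in> carrier R" "r \<odot>\<^bsub>M\<^esub> x = \<zero>\<^bsub>M\<^esub>"
    by (auto simp: annihilator_def)
  have "r \<odot>\<^bsub>M\<^esub> (s \<odot>\<^bsub>M\<^esub> x) = s \<odot>\<^bsub>M\<^esub> (r \<odot>\<^bsub>M\<^esub> x)"
    using r(1) assms by (simp add: smult_assoc1[symmetric] R.m_comm)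
  then show "r \<in> annihilator R M (s \<odot>\<^bsub>M\<^esub> x)"
    using r assms by (simp add: annihilator_def)
qed

text \<open>
  The annihilator of \<open>s x\<close> is the colon ideal \<open>(ann x : s)\<close>, and a prime containing \<open>ann x\<close> contains
  the whole colon ideal as soon as it avoids \<open>s\<close>.
\<close>

lemma (in module) annihilator_smult_subset_prime:
  assumes \<pp>: "primeideal \<pp> R" and sub: "annihilator R M x \<subseteq> \<pp>"
    and s: "s \<in> carrier R" "s \<notin> \<pp>" and x: "x \<in> carrier M"
  shows "annihilator R M (s \<odot>\<^bsub>M\<^esub> x) \<subseteq> \<pp>"
proof
  fix r assume "r \<in> annihilator R M (s \<odot>\<^bsub>M\<^esub> x)"
  then have r: "r \<in> carrier R" "r \<odot>\<^bsub>M\<^esub> (s \<odot>\<^bsub>M\<^esub> x) = \<zero>\<^bsub>M\<^esub>"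
    by (auto simp: annihilator_def)
  then have "r \<otimes>\<^bsub>R\<^esub> s \<in> annihilator R M x"
    using s(1) x by (simp add: annihilator_def smult_assoc1)
  then show "r \<in> \<pp>"
    using sub primeideal.I_prime[OF \<pp> r(1) s(1)] s(2) by blast
qed

lemma (in module) annihilator_quotient_module:
  assumes N: "submodule N R M" and x: "x \<in> carrier M"
  shows "annihilator R (quotient_module M N) (N +>\<^bsub>M\<^esub> x) = {r \<in> carrier R. r \<odot>\<^bsub>M\<^esub> x \<in> N}"
proof -
  interpret N: abelian_subgroup N M
    using N by (intro abelian_subgroupI3 additive_subgroup.intro)
      (auto simp: submodule_def abelian_group_axioms)
  have zero: "\<zero>\<^bsub>quotient_module M N\<^esub> = N"
    by (simp add: quotient_module_def)
  have "N +>\<^bsub>M\<^esub> y = N \<longleftrightarrow> y \<in> N" if "y \<in> carrier M" for y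
    using that N.a_rcos_self N.a_rcos_const by metis
  then show ?thesis
    using x by (simp add: annihilator_def smult_rcos[OF N] zero cong: conj_cong)
qed

text \<open>
  The dichotomy is whether the image of \<open>x\<close> in \<open>M/N\<close> can replace \<open>x\<close>. Its annihilator is
  \<open>(N : x) \<supseteq> ann x\<close>. If this lies in \<open>\<pp>\<close>, then \<open>\<pp>\<close> comes from \<open>M/N\<close>; otherwise some \<open>s \<notin> \<pp>\<close> moves
  \<open>x\<close> into \<open>N\<close>, and \<open>s x\<close> replaces \<open>x\<close>.
\<close>

theorem (in module) weak_assassin_subset_submodule_quotient:
  assumes N: "submodule N R M"
  shows "weak_assassin R M \<subseteq>
    weak_assassin R (M\<lparr>carrier := N\<rparr>) \<union> weak_assassin R (quotient_module M N)"
proof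
  fix \<pp> assume "\<pp> \<in> weak_assassin R M"
  then obtain x where \<pp>: "primeideal \<pp> R" and x: "x \<in> carrier M"
    and min: "minimal_prime_over R (annihilator R M x) \<pp>"
    by (auto simp: weak_assassin_def)
  have sub: "annihilator R M x \<subseteq> \<pp>"
    using min by (auto simp: minimal_prime_over_def Var_def)
  let ?J = "{r \<in> carrier R. r \<odot>\<^bsub>M\<^esub> x \<in> N}"
  show "\<pp> \<in> weak_assassin R (M\<lparr>carrier := N\<rparr>) \<union> weak_assassin R (quotient_module M N)"
  proof (cases "?J \<subseteq> \<pp>")
    case True
    have "annihilator R M x \<subseteq> ?J"
      using N subgroup.one_closed[of N "add_monoid M"]
      by (auto simp: annihilator_def submodule_def)
    then have "minimal_prime_over R (annihilator R (quotient_module M N) (N +>\<^bsub>M\<^esub> x)) \<pp>"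
      using minimal_prime_over_between[OF min _ True] annihilator_quotient_module[OF N x] by simp
    moreover have "N +>\<^bsub>M\<^esub> x \<in> carrier (quotient_module M N)"
      using x by (auto simp: quotient_module_def A_RCOSETS_def' a_r_coset_def r_coset_def)
    ultimately show ?thesis
      using \<pp> by (auto simp: weak_assassin_def)
  next
    case False
    then obtain s where s: "s \<in> carrier R" "s \<odot>\<^bsub>M\<^esub> x \<in> N" "s \<notin> \<pp>"
      by blast
    have "minimal_prime_over R (annihilator R M (s \<odot>\<^bsub>M\<^esub> x)) \<pp>"
      using minimal_prime_over_between[OF min annihilator_subset_smult[OF s(1) x]
          annihilator_smult_subset_prime[OF \<pp> sub s(1,3) x]] .
    then show ?thesis
      using \<pp> s(2) by (auto simp: weak_assassin_def annihilator_def)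
  qed
qed

lemma (in module) weak_assassin_torsion_subset:
  assumes \<aa>: "ideal \<aa> R"
  shows "weak_assassin R (torsion_module R \<aa> M) \<subseteq> weak_assassin R M \<inter> Var R \<aa>"
proof
  fix \<pp> assume "\<pp> \<in> weak_assassin R (torsion_module R \<aa> M)"
  then obtain x where \<pp>: "primeideal \<pp> R" and x: "x \<in> torsion R \<aa> M"
    and min: "minimal_prime_over R (annihilator R M x) \<pp>"
    by (auto simp: weak_assassin_def torsion_module_def annihilator_def)
  obtain n :: nat where n: "\<forall>r \<in> \<aa> [^]\<^bsub>ideals_set R\<^esub> n. r \<odot>\<^bsub>M\<^esub> x = \<zero>\<^bsub>M\<^esub>"
    using x by (auto simp: torsion_def)
  have "\<aa> [^]\<^bsub>ideals_set R\<^esub> n \<subseteq> annihilator R M x"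
    using n ideal.Icarr[OF R.ideal_power_is_ideal[OF \<aa>]] by (auto simp: annihilator_def)
  also have "\<dots> \<subseteq> \<pp>"
    using min by (auto simp: minimal_prime_over_def Var_def)
  finally have "\<aa> \<subseteq> \<pp>"
    by (rule R.ideal_power_subset_prime[OF \<aa> \<pp>])
  moreover have "x \<in> carrier M"
    using x by (simp add: torsion_def)
  ultimately show "\<pp> \<in> weak_assassin R M \<inter> Var R \<aa>"
    using \<pp> min by (auto simp: weak_assassin_def Var_def)
qed

theorem mainTheorem2:
  fixes R :: "('a, 'r) ring_scheme"
    and M :: "('a, 'b, 'm) module_scheme"
    and \<aa> :: "'a set"
  assumes "cring R"
    and "ideal \<aa> R"
    and "module R M"
    and "weakly_fair R \<aa> M"
  shows "weakly_quasifair R \<aa> M"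
proof -
  interpret module R M by fact
  have "weak_assassin R M \<inter> Var R \<aa> \<subseteq> weak_assassin R (torsion_module R \<aa> M)"
    using weak_assassin_subset_submodule_quotient[OF torsion_submodule[OF assms(2)]] assms(4)
    unfolding weakly_fair_def torsion_module_def by blast
  then show ?thesis
    unfolding weakly_quasifair_def using weak_assassin_torsion_subset[OF assms(2)] by blast
qed

end
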